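(* Let $I$ be a finite set of players. For each $\nu\in I$ let $X_\nu\subset\mathbb{R}^{n_\nu}$, let $\succeq_\nu$ be a binary relation on $\mathbb{R}^n=\prod_{\nu\in I}\mathbb{R}^{n_\nu}$, and let $K_\nu:X_{-\nu}\rightrightarrows X_\nu$ be a set-valued map, where $X_{-\nu}=\prod_{j\ne\nu}X_j$. Assume that for each $\nu\in I$: (1) $X_\nu$ is non-empty, convex and compact; (2) $K_\nu$ is continuous with non-empty, closed and convex values; (3) $U^s_\nu(x)$ is convex and open for all $x\in\mathbb{R}^n$; (4) $U^s_\nu:\mathbb{R}^n\rightrightarrows\mathbb{R}^{n_\nu}$ is lower hemicontinuous. Then there exists at least one generalized Nash equilibrium.
   Context: Vectors $x\in\mathbb{R}^n$ are written $x=(x^\nu,x^{-\nu})$. The induced relation is $x^\nu\succeq_{\nu,w^{-\nu}}y^\nu$ iff $(x^\nu,w^{-\nu})\succeq_\nu(y^\nu,w^{-\nu})$, with asymmetric part $\succ_{\nu,w^{-\nu}}$ ($a\succ b$ iff $a\succeq b$ and not $b\succeq a$). $U^s_\nu(x)=\{y^\nu\in\mathbb{R}^{n_\nu}:y^\nu\succ_{\nu,x^{-\nu}}x^\nu\}$. With $X=\prod_\nu X_\nu$ and $K(x)=\prod_\nu K_\nu(x^{-\nu})$, a point $\hat x\in K(\hat x)$ is a generalized Nash equilibrium if for each $\nu\in I$ there is no $x^\nu\in K_\nu(\hat x^{-\nu})$ with $x^\nu\succ_{\nu,\hat x^{-\nu}}\hat x^\nu$. A set-valued map $F$ is upper hemicontinuous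 at $x$ if for every open $V\supset F(x)$ the set $\{z:F(z)\subset V\}$ is a neighborhood of $x$; lower hemicontinuous at $x$ if for every open $V$ with $V\cap F(x)\neq\emptyset$ the set $\{z:F(z)\cap V\ne\emptyset\}$ is a neighborhood of $x$; continuous if both, at every point. *)

theory Defs
  imports "HOL-Analysis.Analysis"
begin

text \<open>Conventions. The players form a finite set I. The Euclidean space R^k is
  represented, as in the library theory Abstract_Euclidean_Space, by the topology
  Euclidean_space k on functions nat => real vanishing from index k on.
  A strategy profile x in R^n = prod_{nu in I} R^{n_nu} is a function
  'i => (nat => real) in the product topology (extensional outside I).
  The profile (y^nu, w^{-nu}) is w(nu := y); the component x^{-nu} is
  restrict x (I - {nu}).\<close>

type_synonym vec = "nat \<Rightarrow> real"

text \<open>Convexity of a set of vectors (the usual definition, written out since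
  nat => real is not a real_vector instance).\<close>
definition fconvex :: "vec set \<Rightarrow> bool" where
  "fconvex S \<longleftrightarrow> (\<forall>x\<in>S. \<forall>y\<in>S. \<forall>u::real. 0 \<le> u \<and> u \<le> 1 \<longrightarrow>
      (\<lambda>i. (1 - u) * x i + u * y i) \<in> S)"

definition uhc_at :: "'a topology \<Rightarrow> 'b topology \<Rightarrow> ('a \<Rightarrow> 'b set) \<Rightarrow> 'a \<Rightarrow> bool" where
  "uhc_at T S F x \<longleftrightarrow> (\<forall>V. openin S V \<and> F x \<subseteq> V \<longrightarrow>
      (\<exists>U. openin T U \<and> x \<in> U \<and> (\<forall>z\<in>U. F z \<subseteq> V)))"

definition lhc_at :: "'a topology \<Rightarrow> 'b topology \<Rightarrow> ('a \<Rightarrow> 'b set) \<Rightarrow> 'a \<Rightarrow> bool" where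
  "lhc_at T S F x \<longleftrightarrow> (\<forall>V. openin S V \<and> V \<inter> F x \<noteq> {} \<longrightarrow>
      (\<exists>U. openin T U \<and> x \<in> U \<and> (\<forall>z\<in>U. F z \<inter> V \<noteq> {})))"

definition lhc :: "'a topology \<Rightarrow> 'b topology \<Rightarrow> ('a \<Rightarrow> 'b set) \<Rightarrow> bool" where
  "lhc T S F \<longleftrightarrow> (\<forall>x\<in>topspace T. lhc_at T S F x)"

definition hcont :: "'a topology \<Rightarrow> 'b topology \<Rightarrow> ('a \<Rightarrow> 'b set) \<Rightarrow> bool" where
  "hcont T S F \<longleftrightarrow> (\<forall>x\<in>topspace T. uhc_at T S F x \<and> lhc_at T S F x)"

definition prof_top :: "'i set \<Rightarrow> ('i \<Rightarrow> nat) \<Rightarrow> ('i \<Rightarrow> vec) topology" where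
  "prof_top I n = product_topology (\<lambda>\<nu>. Euclidean_space (n \<nu>)) I"

definition strict_pref ::
  "('i \<Rightarrow> ('i \<Rightarrow> vec) \<Rightarrow> ('i \<Rightarrow> vec) \<Rightarrow> bool) \<Rightarrow> 'i \<Rightarrow> ('i \<Rightarrow> vec) \<Rightarrow> vec \<Rightarrow> vec \<Rightarrow> bool" where
  "strict_pref R \<nu> w a b \<longleftrightarrow> R \<nu> (w(\<nu> := a)) (w(\<nu> := b)) \<and> \<not> R \<nu> (w(\<nu> := b)) (w(\<nu> := a))"

definition Us ::
  "('i \<Rightarrow> nat) \<Rightarrow> ('i \<Rightarrow> ('i \<Rightarrow> vec) \<Rightarrow> ('i \<Rightarrow> vec) \<Rightarrow> bool) \<Rightarrow> 'i \<Rightarrow> ('i \<Rightarrow> vec) \<Rightarrow> vec set" where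
  "Us n R \<nu> x = {y \<in> topspace (Euclidean_space (n \<nu>)). strict_pref R \<nu> x y (x \<nu>)}"

definition is_GNE ::
  "'i set \<Rightarrow> ('i \<Rightarrow> vec set) \<Rightarrow> ('i \<Rightarrow> ('i \<Rightarrow> vec) \<Rightarrow> ('i \<Rightarrow> vec) \<Rightarrow> bool)
     \<Rightarrow> ('i \<Rightarrow> ('i \<Rightarrow> vec) \<Rightarrow> vec set) \<Rightarrow> ('i \<Rightarrow> vec) \<Rightarrow> bool" where
  "is_GNE I X R K xh \<longleftrightarrow> xh \<in> PiE I X \<and>
     (\<forall>\<nu>\<in>I. xh \<nu> \<in> K \<nu> (restrict xh (I - {\<nu>}))) \<and>
     (\<forall>\<nu>\<in>I. \<not> (\<exists>y \<in> K \<nu> (restrict xh (I - {\<nu>})). strict_pref R \<nu> xh y (xh \<nu>)))"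

end

theory Submission
  imports Defs "HOL-Homology.Brouwer_Degree"
begin

text \<open>
  Let \<open>C \<nu> z\<close> be the set of actions feasible for \<open>\<nu>\<close> at the profile \<open>z\<close>. For \<open>e > 0\<close> let player \<open>\<nu>\<close> like,
  at \<open>z\<close>, the actions in the \<open>e\<close>-neighbourhood of \<open>C \<nu> z\<close> that lie in \<open>Us n R \<nu> z\<close>, the latter condition
  being dropped in the interior of the set of profiles \<open>z\<close> with \<open>z \<nu>\<close> outside that neighbourhood. The
  sets of liked actions are convex, have open lower sections (the graph of \<open>Us n R \<nu>\<close> is open, because
  \<open>Us n R \<nu>\<close> is lower hemicontinuous with open convex values in finite dimension) and never contain
  \<open>z \<nu>\<close>. If at every profile somebody liked some action, then finitely many candidate actions would
  suffice by compactness, and a fixed point of Nash's map on their weights would be a profile \<open>z\<close> at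
  which some \<open>z \<nu>\<close> is an average of actions that \<open>\<nu>\<close> likes, a contradiction. Hence for every \<open>e\<close>
  there is a profile at which nobody likes anything, and these profiles cluster at an equilibrium as \<open>e\<close>
  tends to 0.
\<close>

subsection \<open>Brouwer's fixed point theorem\<close>

lemma continuous_map_into_Euclidean_space:
  "continuous_map T (Euclidean_space k) f \<longleftrightarrow>
    (\<forall>i. continuous_map T euclideanreal (\<lambda>x. f x i)) \<and> (\<forall>x\<in>topspace T. \<forall>i\<ge>k. f x i = 0)"
  by (auto simp: Euclidean_space_def continuous_map_in_subtopology continuous_map_componentwise_UNIV)

lemma continuous_map_Euclidean_space_coordinate:
  "continuous_map (Euclidean_space k) euclideanreal (\<lambda>x. x i)"
  unfolding Euclidean_space_def
  by (intro continuous_map_from_subtopology continuous_map_product_coordinates) simp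

definition sphere_projection :: "nat \<Rightarrow> vec \<Rightarrow> vec" where
  "sphere_projection p x = (\<lambda>i. x i / sqrt (\<Sum>j\<le>p. (x j)\<^sup>2))"

lemma sphere_projection_scale:
  assumes "0 < R" "x \<in> topspace (nsphere p)"
  shows "sphere_projection p (\<lambda>i. R * x i) = x"
  using assms
  by (simp add: sphere_projection_def nsphere power_mult_distrib real_sqrt_mult flip: sum_distrib_left)

lemma continuous_map_sphere_projection:
  "continuous_map (subtopology (Euclidean_space (Suc p)) (- {\<lambda>i. 0})) (nsphere p) (sphere_projection p)"
proof -
  let ?Y = "subtopology (Euclidean_space (Suc p)) (- {\<lambda>i. 0})"
  have positive: "(\<Sum>j\<le>p. (x j)\<^sup>2) > 0" if "x \<in> topspace ?Y" for x
  proof (rule ccontr)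
    assume "\<not> ?thesis"
    then have "(\<Sum>j\<le>p. (x j)\<^sup>2) = 0"
      by (meson sum_nonneg not_less order_antisym zero_le_power2)
    then have "x i = 0" for i
      using that by (cases "i \<le> p") (auto simp: sum_nonneg_eq_0_iff topspace_Euclidean_space)
    with that show False by auto
  qed
  have "continuous_map ?Y euclideanreal (\<lambda>x. sphere_projection p x i)" for i
    unfolding sphere_projection_def
    by (intro continuous_intros continuous_map_from_subtopology
        continuous_map_Euclidean_space_coordinate) (use positive in fastforce)+
  moreover have "(\<Sum>i\<le>p. (sphere_projection p x i)\<^sup>2) = 1" if "x \<in> topspace ?Y" for x
    using positive[OF that] by (simp add: sphere_projection_def power_divide flip: sum_divide_distrib)
  ultimately show ?thesis
    by (auto simp: nsphere_def continuous_map_in_subtopology continuous_map_into_Euclidean_space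
        topspace_Euclidean_space sphere_projection_def)
qed

lemma dilation_diff_nonzero:
  assumes x: "x \<in> topspace (nsphere p)" and v: "(\<Sum>i\<le>p. (v i)\<^sup>2) < R\<^sup>2" and t: "0 \<le> t" "t \<le> 1"
  shows "(\<lambda>i. R * x i - t * v i) \<noteq> (\<lambda>i. 0)"
proof
  assume "(\<lambda>i. R * x i - t * v i) = (\<lambda>i. 0)"
  then have "R * x i = t * v i" for i
    by (auto simp: fun_eq_iff)
  then have "R\<^sup>2 * (\<Sum>i\<le>p. (x i)\<^sup>2) = t\<^sup>2 * (\<Sum>i\<le>p. (v i)\<^sup>2)"
    by (simp add: sum_distrib_left flip: power_mult_distrib)
  also have "\<dots> \<le> 1 * (\<Sum>i\<le>p. (v i)\<^sup>2)"
    using t by (intro mult_right_mono) (auto simp: power_le_one sum_nonneg)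
  finally show False
    using v x by (simp add: nsphere)
qed

lemma homotopic_with_id_sphere_projection_diff:
  assumes g: "continuous_map (nsphere p) (Euclidean_space (Suc p)) g"
    and small: "\<And>x. x \<in> topspace (nsphere p) \<Longrightarrow> (\<Sum>i\<le>p. (g x i)\<^sup>2) < R\<^sup>2" and "0 < R"
  shows "homotopic_with (\<lambda>_. True) (nsphere p) (nsphere p) id
    (\<lambda>x. sphere_projection p (\<lambda>i. R * x i - g x i))"
proof -
  let ?T = "prod_topology (top_of_set {0..1}) (nsphere p)"
  let ?h = "\<lambda>(t, x) i. R * x i - t * g x i"
  have coordinates: "continuous_map (nsphere p) euclideanreal (\<lambda>x. g x i)" for i
    using g by (simp add: continuous_map_into_Euclidean_space)
  have "continuous_map ?T euclideanreal (\<lambda>z. R * snd z i - fst z * g (snd z) i)" for i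
    by (intro continuous_intros continuous_map_into_fulltopology[OF continuous_map_fst]
        continuous_map_compose[OF continuous_map_snd continuous_map_nsphere_projection, unfolded o_def]
        continuous_map_compose[OF continuous_map_snd coordinates, unfolded o_def])
  then have "continuous_map ?T (Euclidean_space (Suc p)) ?h"
    using g by (auto simp: continuous_map_into_Euclidean_space case_prod_unfold nsphere)
  moreover have "?h (t, x) \<noteq> (\<lambda>i. 0)" if "0 \<le> t" "t \<le> 1" and x: "x \<in> topspace (nsphere p)" for t x
    using dilation_diff_nonzero[OF x small[OF x] that(1,2)] by simp
  ultimately have "continuous_map ?T (subtopology (Euclidean_space (Suc p)) (- {\<lambda>i. 0})) ?h"
    by (auto simp: continuous_map_in_subtopology)
  then have "continuous_map ?T (nsphere p) (sphere_projection p \<circ> ?h)"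
    using continuous_map_sphere_projection by (rule continuous_map_compose)
  then show ?thesis
    by (subst homotopic_with) (auto simp: o_def sphere_projection_scale[OF \<open>0 < R\<close>])
qed

lemma nullhomotopic_sphere_projection_displacement:
  fixes f :: "vec \<Rightarrow> vec"
  assumes f: "continuous_map (Euclidean_space (Suc p)) (Euclidean_space (Suc p)) f"
    and no_fixpoint: "\<And>x. x \<in> topspace (Euclidean_space (Suc p)) \<Longrightarrow> f x \<noteq> x"
    and g: "continuous_map T (Euclidean_space (Suc p)) g"
  obtains c where "homotopic_with (\<lambda>_. True) T (nsphere p)
    (\<lambda>x. sphere_projection p (\<lambda>i. g x i - f (g x) i)) (\<lambda>_. c)"
proof -
  let ?E = "Euclidean_space (Suc p)"
  define displacement where "displacement x = (\<lambda>i. x i - f x i)" for x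
  have "continuous_map ?E ?E displacement"
    using f by (simp add: continuous_map_into_Euclidean_space displacement_def continuous_map_diff
        continuous_map_Euclidean_space_coordinate topspace_Euclidean_space)
  moreover have "displacement x \<noteq> (\<lambda>i. 0)" if "x \<in> topspace ?E" for x
    using no_fixpoint[OF that, THEN not_sym] by (simp add: displacement_def fun_eq_iff)
  ultimately have "continuous_map ?E (subtopology ?E (- {\<lambda>i. 0})) displacement"
    by (auto simp: continuous_map_in_subtopology)
  then have "continuous_map ?E (nsphere p) (sphere_projection p \<circ> displacement)"
    using continuous_map_sphere_projection by (rule continuous_map_compose)
  then obtain c where "homotopic_with (\<lambda>_. True) T (nsphere p)
      (sphere_projection p \<circ> displacement \<circ> g) (\<lambda>_. c)"
    using nullhomotopic_through_contractible_space[OF g _ contractible_Euclidean_space] by blast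
  then show thesis
    using that by (simp add: o_def displacement_def)
qed

lemma sum_squares_less:
  fixes v :: "nat \<Rightarrow> real"
  assumes "\<And>i. \<bar>v i\<bar> \<le> B"
  shows "(\<Sum>i\<le>p. (v i)\<^sup>2) < (real (Suc p) * B + 1)\<^sup>2"
proof -
  have "0 \<le> B"
    using assms[of 0] by linarith
  have "(\<Sum>i\<le>p. (v i)\<^sup>2) \<le> (\<Sum>i\<le>p. B\<^sup>2)"
    using power_mono[OF assms abs_ge_zero, where n = 2] by (intro sum_mono) simp
  also have "\<dots> \<le> (real (Suc p))\<^sup>2 * B\<^sup>2"
    using self_le_power[of "real (Suc p)" 2] by (simp add: mult_right_mono del: of_nat_Suc)
  also have "\<dots> = (real (Suc p) * B)\<^sup>2"
    by (simp add: power_mult_distrib)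
  also have "\<dots> < (real (Suc p) * B + 1)\<^sup>2"
    using \<open>0 \<le> B\<close> by (intro power_strict_mono) auto
  finally show ?thesis .
qed

text \<open>The dimension will be the number of sets in a finite subcover, so that \<open>brouwer\<close>, where it is
  fixed by a type, does not apply. On a sphere of radius exceeding all values of \<open>f\<close>, the normalized
  displacement \<open>x - f x\<close> is homotopic to the identity; without fixed points it would also be
  nullhomotopic.\<close>

theorem Brouwer_Euclidean_space:
  fixes f :: "vec \<Rightarrow> vec"
  assumes f: "continuous_map (Euclidean_space m) (Euclidean_space m) f"
    and bound: "\<And>x i. x \<in> topspace (Euclidean_space m) \<Longrightarrow> \<bar>f x i\<bar> \<le> B"
  obtains x where "x \<in> topspace (Euclidean_space m)" "f x = x"
proof (cases m)
  case 0
  then have "f (\<lambda>i. 0) = (\<lambda>i. 0)"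
    using f by (auto simp: continuous_map_def topspace_Euclidean_space)
  then show thesis
    using that[of "\<lambda>i. 0"] by (simp add: topspace_Euclidean_space)
next
  case (Suc p)
  let ?E = "Euclidean_space (Suc p)"
  define R where "R = real (Suc p) * B + 1"
  have "0 \<le> B"
    using bound[of "\<lambda>i. 0"] by (force simp: topspace_Euclidean_space)
  then have "0 < R" by (simp add: R_def add_nonneg_pos)
  have f': "continuous_map ?E ?E f"
    using f Suc by simp
  have dilation: "continuous_map (nsphere p) ?E (\<lambda>x i. R * x i)"
    by (auto simp: continuous_map_into_Euclidean_space nsphere_def topspace_Euclidean_space
        intro!: continuous_map_real_mult continuous_map_nsphere_projection[unfolded nsphere_def])
  have small: "(\<Sum>i\<le>p. (f x i)\<^sup>2) < R\<^sup>2" if "x \<in> topspace ?E" for x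
    unfolding R_def using that Suc bound by (intro sum_squares_less) auto
  have "\<exists>x\<in>topspace ?E. f x = x"
  proof (rule ccontr)
    assume "\<not> ?thesis"
    then obtain c where "homotopic_with (\<lambda>_. True) (nsphere p) (nsphere p)
        (\<lambda>x. sphere_projection p (\<lambda>i. R * x i - f (\<lambda>i. R * x i) i)) (\<lambda>_. c)"
      using nullhomotopic_sphere_projection_displacement[OF f' _ dilation] by blast
    moreover have "homotopic_with (\<lambda>_. True) (nsphere p) (nsphere p) id
        (\<lambda>x. sphere_projection p (\<lambda>i. R * x i - f (\<lambda>i. R * x i) i))"
      using homotopic_with_id_sphere_projection_diff[OF continuous_map_compose[OF dilation f'] _ \<open>0 < R\<close>]
        small continuous_map_image_subset_topspace[OF dilation] by (simp add: o_def image_subset_iff)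
    ultimately show False
      using homotopic_with_trans non_contractible_space_nsphere contractible_space_def by blast
  qed
  then show thesis
    using that Suc by blast
qed

subsection \<open>Convexity and cubes\<close>

lemma fconvexD:
  assumes "fconvex C" "x \<in> C" "y \<in> C" "0 \<le> u" "u \<le> 1"
  shows "(\<lambda>i. (1 - u) * x i + u * y i) \<in> C"
  using assms unfolding fconvex_def by blast

lemma fconvex_Int: "fconvex C \<Longrightarrow> fconvex D \<Longrightarrow> fconvex (C \<inter> D)"
  by (simp add: fconvex_def)

lemma fconvex_weighted_sum:
  assumes "fconvex C" "C \<noteq> {}" "finite A" "\<And>a. a \<in> A \<Longrightarrow> 0 \<le> w a" "\<And>a. a \<in> A \<Longrightarrow> g a \<in> C"
  obtains c where "c \<in> C" "\<And>i. (\<Sum>a\<in>A. w a * g a i) = sum w A * c i"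
proof -
  have "\<exists>c\<in>C. \<forall>i. (\<Sum>a\<in>A. w a * g a i) = sum w A * c i"
    using assms(3-)
  proof (induction rule: finite_induct)
    case empty
    then show ?case using \<open>C \<noteq> {}\<close> by auto
  next
    case (insert a A)
    then obtain c where c: "c \<in> C" "\<And>i. (\<Sum>a\<in>A. w a * g a i) = sum w A * c i"
      by auto
    have nonneg: "0 \<le> w a" "0 \<le> sum w A"
      using insert.prems by (auto intro: sum_nonneg)
    define u where "u = w a / (w a + sum w A)"
    have "0 \<le> u" "u \<le> 1" and u: "u * (w a + sum w A) = w a"
      using nonneg by (auto simp: u_def divide_le_eq_1)
    then have mem: "(\<lambda>i. (1 - u) * c i + u * g a i) \<in> C"
      using fconvexD[OF \<open>fconvex C\<close> c(1)] insert.prems by blast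
    have "(\<Sum>b\<in>insert a A. w b * g b i) = sum w (insert a A) * ((1 - u) * c i + u * g a i)" for i
    proof -
      have "sum w (insert a A) * ((1 - u) * c i + u * g a i)
          = (w a + sum w A - u * (w a + sum w A)) * c i + u * (w a + sum w A) * g a i"
        using insert.hyps by (simp add: algebra_simps)
      then show ?thesis
        unfolding u using insert.hyps c(2) by simp
    qed
    then show ?case
      by (intro bexI[OF _ mem] allI)
  qed
  with that show thesis by blast
qed

lemma fconvex_subconvex_combination:
  assumes "fconvex C" "x \<in> C" "finite A" "\<And>a. a \<in> A \<Longrightarrow> 0 \<le> w a" "\<And>a. a \<in> A \<Longrightarrow> g a \<in> C" "sum w A \<le> 1"
  shows "(\<lambda>i. (1 - sum w A) * x i + (\<Sum>a\<in>A. w a * g a i)) \<in> C"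
proof -
  have "C \<noteq> {}" using \<open>x \<in> C\<close> by blast
  then obtain c where "c \<in> C" "\<And>i. (\<Sum>a\<in>A. w a * g a i) = sum w A * c i"
    using fconvex_weighted_sum[OF assms(1) _ assms(3), of w g] assms(4,5) by blast
  then show ?thesis
    using fconvexD[OF assms(1,2)] assms(4,6) by (simp add: sum_nonneg)
qed

lemma mem_fconvex_if_weighted_average:
  assumes "fconvex C" "finite A" and nonneg: "\<And>a. a \<in> A \<Longrightarrow> 0 \<le> w a"
    and mem: "\<And>a. a \<in> A \<Longrightarrow> 0 < w a \<Longrightarrow> g a \<in> C" and pos: "0 < sum w A"
    and average: "\<And>i. sum w A * x i = (\<Sum>a\<in>A. w a * g a i)"
  shows "x \<in> C"
proof -
  let ?A = "{a \<in> A. 0 < w a}"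
  have support: "(\<Sum>a\<in>A. w a * h a) = (\<Sum>a\<in>?A. w a * h a)" for h
    using \<open>finite A\<close> nonneg by (intro sum.mono_neutral_right) (auto simp: less_le)
  have "?A \<noteq> {}"
    using pos support[of "\<lambda>_. 1"] by force
  then have "C \<noteq> {}"
    using mem by blast
  then obtain c where c: "c \<in> C" "\<And>i. (\<Sum>a\<in>?A. w a * g a i) = sum w ?A * c i"
    using fconvex_weighted_sum[OF \<open>fconvex C\<close>, of ?A w g] \<open>finite A\<close> nonneg mem by auto
  have "sum w A * x i = sum w A * c i" for i
    using average c(2) support[of "\<lambda>a. g a i"] support[of "\<lambda>_. 1"] by simp
  then have "x = c"
    using pos by (simp add: fun_eq_iff)
  with c(1) show ?thesis by simp
qed

definition cube :: "real \<Rightarrow> vec \<Rightarrow> vec set" where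
  "cube e x = {y. \<forall>i. \<bar>y i - x i\<bar> < e}"

definition cube_neighbourhood :: "real \<Rightarrow> vec set \<Rightarrow> vec set" where
  "cube_neighbourhood e C = (\<Union>x\<in>C. cube e x)"

lemma cube_commute: "y \<in> cube e x \<longleftrightarrow> x \<in> cube e y"
  by (simp add: cube_def abs_minus_commute)

lemma cube_triangle:
  assumes "y \<in> cube d x" "z \<in> cube e y"
  shows "z \<in> cube (d + e) x"
  unfolding cube_def
proof safe
  fix i
  have "\<bar>y i - x i\<bar> < d" "\<bar>z i - y i\<bar> < e"
    using assms by (auto simp: cube_def)
  then show "\<bar>z i - x i\<bar> < d + e" by linarith
qed

lemma centre_in_cube: "0 < e \<Longrightarrow> x \<in> cube e x"
  by (simp add: cube_def)

lemma cube_mono: "d \<le> e \<Longrightarrow> cube d x \<subseteq> cube e x"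
  by (auto simp: cube_def intro: less_le_trans)

lemma mem_cube_Euclidean_space_iff:
  assumes "x \<in> topspace (Euclidean_space k)" "y \<in> topspace (Euclidean_space k)" "0 < e"
  shows "y \<in> cube e x \<longleftrightarrow> (\<forall>i<k. \<bar>y i - x i\<bar> < e)"
proof -
  have "\<bar>y i - x i\<bar> < e" if "\<not> i < k" for i
    using assms that by (simp add: topspace_Euclidean_space)
  then show ?thesis
    by (auto simp: cube_def)
qed

lemma openin_Euclidean_space_cube:
  assumes "x \<in> topspace (Euclidean_space k)" "0 < e"
  shows "openin (Euclidean_space k) (topspace (Euclidean_space k) \<inter> cube e x)"
proof -
  let ?E = "Euclidean_space k"
  have "openin ?E {y \<in> topspace ?E. \<bar>y i - x i\<bar> \<in> {..<e}}" for i
    by (intro openin_continuous_map_preimage[of _ euclideanreal] continuous_intros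
        continuous_map_Euclidean_space_coordinate) auto
  then have "openin ?E (topspace ?E \<inter> (\<Inter>i<k. {y \<in> topspace ?E. \<bar>y i - x i\<bar> < e}))"
    by (intro openin_Int_Inter) auto
  moreover have "topspace ?E \<inter> (\<Inter>i<k. {y \<in> topspace ?E. \<bar>y i - x i\<bar> < e}) = topspace ?E \<inter> cube e x"
    using assms by (auto simp: mem_cube_Euclidean_space_iff)
  ultimately show ?thesis by simp
qed

lemma openin_Euclidean_space_contains_cube:
  assumes "openin (Euclidean_space k) W" "x \<in> W"
  obtains e where "0 < e" "topspace (Euclidean_space k) \<inter> cube e x \<subseteq> W"
proof -
  obtain V where V: "openin (powertop_real UNIV) V" "W = V \<inter> topspace (Euclidean_space k)"
    using assms(1) by (auto simp: Euclidean_space_def openin_subtopology)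
  obtain U where U: "x \<in> PiE UNIV U" "\<And>i. open (U i)" "PiE UNIV U \<subseteq> V"
    using product_topology_open_contains_basis[OF V(1), of x] V(2) assms(2) by auto
  have "\<forall>\<^sub>F e in at_right 0. ball (x i) e \<subseteq> U i" for i
  proof -
    have "x i \<in> U i"
      using U(1) by (auto simp: PiE_iff)
    then obtain d where "0 < d" "ball (x i) d \<subseteq> U i"
      using U(2) open_contains_ball by blast
    then show ?thesis
      unfolding eventually_at_right_field by (meson subset_ball less_imp_le order_trans)
  qed
  then have "\<forall>\<^sub>F e in at_right 0. \<forall>i\<in>{..<k}. ball (x i) e \<subseteq> U i"
    by (simp add: eventually_ball_finite)
  with eventually_at_right_less have "\<forall>\<^sub>F e in at_right 0. 0 < e \<and> (\<forall>i\<in>{..<k}. ball (x i) e \<subseteq> U i)"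
    by (rule eventually_conj)
  then obtain e where "0 < e" and e: "\<And>i. i < k \<Longrightarrow> ball (x i) e \<subseteq> U i"
    using eventually_happens'[OF trivial_limit_at_right_real] by blast
  have "y \<in> W" if y: "y \<in> topspace (Euclidean_space k) \<inter> cube e x" for y
  proof -
    have "y i \<in> U i" for i
    proof (cases "i < k")
      case True
      then show ?thesis
        using y e[OF True] by (auto simp: cube_def dist_real_def abs_minus_commute)
    next
      case False
      then have "y i = x i"
        using y assms(2) V(2) by (simp add: topspace_Euclidean_space)
      then show ?thesis using U(1) by auto
    qed
    then show ?thesis using U(3) V(2) y by auto
  qed
  with \<open>0 < e\<close> that show thesis by blast
qed

lemma subset_cube_neighbourhood: "0 < e \<Longrightarrow> C \<subseteq> cube_neighbourhood e C"
  using centre_in_cube by (auto simp: cube_neighbourhood_def)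

lemma fconvex_cube_neighbourhood:
  assumes "fconvex C"
  shows "fconvex (cube_neighbourhood e C)"
  unfolding fconvex_def
proof (intro ballI allI impI)
  fix x y and u :: real
  assume "x \<in> cube_neighbourhood e C" "y \<in> cube_neighbourhood e C" and u: "0 \<le> u \<and> u \<le> 1"
  then obtain a b where a: "a \<in> C" "x \<in> cube e a" and b: "b \<in> C" "y \<in> cube e b"
    by (auto simp: cube_neighbourhood_def)
  have "\<bar>(1 - u) * x i + u * y i - ((1 - u) * a i + u * b i)\<bar> < e" for i
  proof -
    have "\<bar>(1 - u) * x i + u * y i - ((1 - u) * a i + u * b i)\<bar>
        = \<bar>(1 - u) * (x i - a i) + u * (y i - b i)\<bar>"
      by (simp add: algebra_simps)
    also have "\<dots> \<le> (1 - u) * \<bar>x i - a i\<bar> + u * \<bar>y i - b i\<bar>"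
      using u abs_triangle_ineq[of "(1 - u) * (x i - a i)" "u * (y i - b i)"] by (simp add: abs_mult)
    also have "\<dots> < e"
      using convex_bound_lt[of "\<bar>x i - a i\<bar>" e "\<bar>y i - b i\<bar>" "1 - u" u] u a(2) b(2)
      by (simp add: cube_def)
    finally show ?thesis .
  qed
  then have "(\<lambda>i. (1 - u) * x i + u * y i) \<in> cube e (\<lambda>i. (1 - u) * a i + u * b i)"
    by (simp add: cube_def)
  then show "(\<lambda>i. (1 - u) * x i + u * y i) \<in> cube_neighbourhood e C"
    using fconvexD[OF assms a(1) b(1)] u by (auto simp: cube_neighbourhood_def)
qed

lemma not_mem_cube_neighbourhood_if_close:
  assumes "A \<inter> cube (3 * d) x = {}" "y \<in> cube d x" "B \<subseteq> cube_neighbourhood d A" "e \<le> d"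
  shows "y \<notin> cube_neighbourhood e B"
proof
  assume "y \<in> cube_neighbourhood e B"
  then obtain b where b: "b \<in> B" "y \<in> cube d b"
    using cube_mono[OF \<open>e \<le> d\<close>] by (auto simp: cube_neighbourhood_def)
  then obtain a where a: "a \<in> A" "b \<in> cube d a"
    using assms(3) by (auto simp: cube_neighbourhood_def)
  have "x \<in> cube (d + d + d) a"
    by (rule cube_triangle[OF cube_triangle[OF a(2) b(2)] cube_commute[THEN iffD1, OF assms(2)]])
  then have "a \<in> cube (3 * d) x"
    by (subst cube_commute) simp
  with a(1) assms(1) show False by blast
qed

lemma openin_Euclidean_space_cube_neighbourhood:
  assumes "C \<subseteq> topspace (Euclidean_space k)" "0 < e"
  shows "openin (Euclidean_space k) (topspace (Euclidean_space k) \<inter> cube_neighbourhood e C)"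
proof -
  have "openin (Euclidean_space k) (\<Union>x\<in>C. topspace (Euclidean_space k) \<inter> cube e x)"
    using assms by (intro openin_Union) (auto intro: openin_Euclidean_space_cube)
  then show ?thesis
    by (simp only: cube_neighbourhood_def Int_UN_distrib)
qed

subsection \<open>Hemicontinuity\<close>

lemma openin_Collect_topspace_iff:
  "openin T {x \<in> topspace T. P x} \<longleftrightarrow>
    (\<forall>x\<in>topspace T. P x \<longrightarrow> (\<exists>U. openin T U \<and> x \<in> U \<and> (\<forall>z\<in>U. P z)))"
proof
  assume "openin T {x \<in> topspace T. P x}"
  then show "\<forall>x\<in>topspace T. P x \<longrightarrow> (\<exists>U. openin T U \<and> x \<in> U \<and> (\<forall>z\<in>U. P z))"
    by (intro ballI impI exI[of _ "{x \<in> topspace T. P x}"]) auto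
next
  assume local: "\<forall>x\<in>topspace T. P x \<longrightarrow> (\<exists>U. openin T U \<and> x \<in> U \<and> (\<forall>z\<in>U. P z))"
  show "openin T {x \<in> topspace T. P x}"
  proof (subst openin_subopen, intro ballI)
    fix x assume "x \<in> {x \<in> topspace T. P x}"
    then obtain U where "openin T U" "x \<in> U" "\<forall>z\<in>U. P z"
      using local by blast
    then show "\<exists>U. openin T U \<and> x \<in> U \<and> U \<subseteq> {x \<in> topspace T. P x}"
      using openin_subset[of T U] by blast
  qed
qed

lemma lhc_iff_openin:
  "lhc T S F \<longleftrightarrow> (\<forall>V. openin S V \<longrightarrow> openin T {x \<in> topspace T. F x \<inter> V \<noteq> {}})"
  unfolding lhc_def lhc_at_def openin_Collect_topspace_iff Int_commute[of _ "F _"] by meson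

lemma hcont_iff_openin:
  "hcont T S F \<longleftrightarrow> lhc T S F \<and> (\<forall>V. openin S V \<longrightarrow> openin T {x \<in> topspace T. F x \<subseteq> V})"
  unfolding hcont_def uhc_at_def lhc_def openin_Collect_topspace_iff by meson

lemma lhc_compose:
  assumes F: "lhc T S F" and g: "continuous_map T' T g"
  shows "lhc T' S (\<lambda>x. F (g x))"
  unfolding lhc_iff_openin
proof (intro allI impI)
  fix V assume "openin S V"
  then have "openin T' {x \<in> topspace T'. g x \<in> {y \<in> topspace T. F y \<inter> V \<noteq> {}}}"
    using F g by (intro openin_continuous_map_preimage) (auto simp: lhc_iff_openin)
  then show "openin T' {x \<in> topspace T'. F (g x) \<inter> V \<noteq> {}}"
    using continuous_map_image_subset_topspace[OF g] by (simp add: image_subset_iff cong: conj_cong)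
qed

lemma hcont_compose:
  assumes F: "hcont T S F" and g: "continuous_map T' T g"
  shows "hcont T' S (\<lambda>x. F (g x))"
  unfolding hcont_iff_openin
proof (intro conjI allI impI)
  show "lhc T' S (\<lambda>x. F (g x))"
    using F g by (auto simp: hcont_iff_openin intro: lhc_compose)
  fix V assume "openin S V"
  then have "openin T' {x \<in> topspace T'. g x \<in> {y \<in> topspace T. F y \<subseteq> V}}"
    using F g by (intro openin_continuous_map_preimage) (auto simp: hcont_iff_openin)
  then show "openin T' {x \<in> topspace T'. F (g x) \<subseteq> V}"
    using continuous_map_image_subset_topspace[OF g] by (simp add: image_subset_iff cong: conj_cong)
qed

subsection \<open>Open graphs\<close>

definition orthant :: "nat \<Rightarrow> nat set \<Rightarrow> vec \<Rightarrow> vec set" where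
  "orthant k A x = {y. \<forall>i<k. if i \<in> A then x i \<le> y i else y i \<le> x i}"

lemma fconvex_orthant: "fconvex (orthant k A x)"
  unfolding fconvex_def
proof (intro ballI allI impI)
  fix y z and u :: real
  assume y: "y \<in> orthant k A x" and z: "z \<in> orthant k A x" and u: "0 \<le> u \<and> u \<le> 1"
  have "x i \<le> (1 - u) * y i + u * z i" if "x i \<le> y i" "x i \<le> z i" for i
    using convex_bound_le[of "- y i" "- x i" "- z i" "1 - u" u] that u by simp
  moreover have "(1 - u) * y i + u * z i \<le> x i" if "y i \<le> x i" "z i \<le> x i" for i
    using convex_bound_le[of "y i" "x i" "z i" "1 - u" u] that u by simp
  ultimately show "(\<lambda>i. (1 - u) * y i + u * z i) \<in> orthant k A x"
    using y z by (simp add: orthant_def)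
qed

lemma orthant_Suc:
  "orthant (Suc k) (insert k A) x = orthant k A x \<inter> {y. x k \<le> y k}"
  "orthant (Suc k) (A - {k}) x = orthant k A x \<inter> {y. y k \<le> x k}"
  by (auto simp: orthant_def less_Suc_eq)

lemma mem_fconvex_if_meets_orthants:
  assumes "fconvex C" and "\<And>y i. y \<in> C \<Longrightarrow> k \<le> i \<Longrightarrow> y i = x i"
    and "\<And>A. C \<inter> orthant k A x \<noteq> {}"
  shows "x \<in> C"
  using assms
proof (induction k arbitrary: C)
  case 0
  then obtain y where "y \<in> C" by fastforce
  moreover from this 0 have "y = x" by auto
  ultimately show ?case by simp
next
  case (Suc k)
  have "x \<in> C \<inter> {y. y k = x k}"
  proof (rule Suc.IH)
    show "fconvex (C \<inter> {y. y k = x k})"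
      using Suc.prems(1) by (intro fconvex_Int) (auto simp: fconvex_def algebra_simps)
    show "y i = x i" if "y \<in> C \<inter> {y. y k = x k}" "k \<le> i" for y i
      using that Suc.prems(2)[of y i] by (cases "i = k") auto
    show "C \<inter> {y. y k = x k} \<inter> orthant k A x \<noteq> {}" for A
    proof -
      obtain a where a: "a \<in> C" "a k \<le> x k" "a \<in> orthant k A x"
        using Suc.prems(3)[of "A - {k}"] by (auto simp: orthant_Suc)
      obtain b where b: "b \<in> C" "x k \<le> b k" "b \<in> orthant k A x"
        using Suc.prems(3)[of "insert k A"] by (auto simp: orthant_Suc)
      have "x k \<in> closed_segment (a k) (b k)"
        using a(2) b(2) by (simp add: closed_segment_eq_real_ivl)
      then obtain u where u: "0 \<le> u" "u \<le> 1" "(1 - u) * a k + u * b k = x k"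
        by (auto simp: closed_segment_def)
      have "(\<lambda>i. (1 - u) * a i + u * b i) \<in> C \<inter> orthant k A x"
        using fconvexD[OF Suc.prems(1) a(1) b(1) u(1,2)] fconvexD[OF fconvex_orthant a(3) b(3) u(1,2)]
        by simp
      with u(3) show ?thesis by auto
    qed
  qed
  then show ?case by simp
qed

definition corner :: "nat \<Rightarrow> real \<Rightarrow> vec \<Rightarrow> nat set \<Rightarrow> vec" where
  "corner k d x A = (\<lambda>i. if k \<le> i then 0 else if i \<in> A then x i + d else x i - d)"

lemma corner_in_Euclidean_space: "corner k d x A \<in> topspace (Euclidean_space k)"
  by (simp add: corner_def topspace_Euclidean_space)

lemma corner_in_cube:
  assumes "x \<in> topspace (Euclidean_space k)" "0 < d" "d < e"
  shows "corner k d x A \<in> cube e x"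
  using assms by (simp add: cube_def corner_def topspace_Euclidean_space)

lemma mem_fconvex_if_meets_corner_cubes:
  assumes "fconvex C" and C: "C \<subseteq> topspace (Euclidean_space k)"
    and meets: "\<And>A. A \<subseteq> {..<k} \<Longrightarrow> C \<inter> cube e (corner k (2 * e) x A) \<noteq> {}"
    and y: "y \<in> topspace (Euclidean_space k)" "y \<in> cube e x"
  shows "y \<in> C"
proof (rule mem_fconvex_if_meets_orthants[OF \<open>fconvex C\<close>])
  show "z i = y i" if "z \<in> C" "k \<le> i" for z i
    using C that y(1) by (auto simp: topspace_Euclidean_space)
  show "C \<inter> orthant k A y \<noteq> {}" for A
  proof -
    obtain z where z: "z \<in> C" "z \<in> cube e (corner k (2 * e) x (A \<inter> {..<k}))"
      using meets[of "A \<inter> {..<k}"] by blast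
    have "z \<in> orthant k A y"
      unfolding orthant_def
    proof safe
      fix i assume "i < k"
      moreover have "\<bar>z i - corner k (2 * e) x (A \<inter> {..<k}) i\<bar> < e" "\<bar>y i - x i\<bar> < e"
        using z(2) y(2) by (auto simp: cube_def)
      ultimately show "if i \<in> A then y i \<le> z i else z i \<le> y i"
        by (auto simp: corner_def)
    qed
    with z(1) show ?thesis by blast
  qed
qed

lemma openin_graph_of_lhc_open_fconvex:
  assumes lhc: "lhc T (Euclidean_space k) F"
    and convex: "\<And>x. x \<in> topspace T \<Longrightarrow> fconvex (F x)"
    and opn: "\<And>x. x \<in> topspace T \<Longrightarrow> openin (Euclidean_space k) (F x)"
  shows "openin (prod_topology T (Euclidean_space k)) (SIGMA x:topspace T. F x)"
  unfolding openin_prod_topology_alt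
proof (intro allI impI)
  let ?E = "topspace (Euclidean_space k)"
  fix x y assume "(x, y) \<in> (SIGMA x:topspace T. F x)"
  then have x: "x \<in> topspace T" and y: "y \<in> F x" by auto
  have F_E: "F z \<subseteq> ?E" if "z \<in> topspace T" for z
    using opn[OF that] by (rule openin_subset)
  have y_E: "y \<in> ?E"
    using F_E[OF x] y by blast
  obtain r where "0 < r" and r: "?E \<inter> cube r y \<subseteq> F x"
    using openin_Euclidean_space_contains_cube[OF opn[OF x] y] by blast
  define e where "e = r / 4"
  have "0 < e" "2 * e < r" using \<open>0 < r\<close> by (simp_all add: e_def)
  let ?V = "\<lambda>A. ?E \<inter> cube e (corner k (2 * e) y A)"
  define W where "W = topspace T \<inter> (\<Inter>A\<in>Pow {..<k}. {z \<in> topspace T. F z \<inter> ?V A \<noteq> {}})"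
  have "openin T W"
    unfolding W_def using lhc openin_Euclidean_space_cube[OF corner_in_Euclidean_space \<open>0 < e\<close>]
    by (intro openin_Int_Inter) (auto simp: lhc_iff_openin)
  moreover have "x \<in> W"
  proof -
    have "corner k (2 * e) y A \<in> F x \<inter> ?V A" for A
      using r corner_in_cube[OF y_E _ \<open>2 * e < r\<close>] corner_in_Euclidean_space[of k "2 * e" y A]
        centre_in_cube \<open>0 < e\<close> by auto
    with x show ?thesis
      unfolding W_def by blast
  qed
  moreover have "openin (Euclidean_space k) (?E \<inter> cube e y)" "y \<in> ?E \<inter> cube e y"
    using y_E \<open>0 < e\<close> by (auto intro: openin_Euclidean_space_cube centre_in_cube)
  moreover have "y' \<in> F x'" if x': "x' \<in> W" and y': "y' \<in> ?E \<inter> cube e y" for x' y'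
    using x' y' convex F_E
    by (intro mem_fconvex_if_meets_corner_cubes[of "F x'" k e y y']) (auto simp: W_def)
  ultimately show "\<exists>U V. openin T U \<and> openin (Euclidean_space k) V \<and> x \<in> U \<and> y \<in> V \<and>
      U \<times> V \<subseteq> (SIGMA x:topspace T. F x)"
    by (intro exI[of _ W] exI[of _ "?E \<inter> cube e y"]) (auto simp: W_def)
qed

subsection \<open>Profiles\<close>

definition profile_space :: "'i set \<Rightarrow> ('i \<Rightarrow> vec set) \<Rightarrow> ('i \<Rightarrow> vec) topology" where
  "profile_space I X = subtopology (product_topology (\<lambda>_. powertop_real UNIV) I) (PiE I X)"

lemma profile_space_eq_product_topology:
  "profile_space I X = product_topology (\<lambda>\<nu>. subtopology (powertop_real UNIV) (X \<nu>)) I"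
  by (simp add: profile_space_def subtopology_product_topology)

lemma topspace_profile_space [simp]: "topspace (profile_space I X) = PiE I X"
  by (simp add: profile_space_eq_product_topology)

lemma subtopology_product_Euclidean_space:
  assumes "\<And>\<nu>. \<nu> \<in> I \<Longrightarrow> X \<nu> \<subseteq> topspace (Euclidean_space (n \<nu>))"
  shows "subtopology (product_topology (\<lambda>\<nu>. Euclidean_space (n \<nu>)) I) (PiE I X) = profile_space I X"
proof -
  have "PiE I X \<subseteq> (\<Pi>\<^sub>E \<nu>\<in>I. {x. \<forall>i\<ge>n \<nu>. x i = 0})"
    using assms by (intro PiE_mono) (simp add: topspace_Euclidean_space)
  then show ?thesis
    by (simp add: profile_space_def Euclidean_space_def subtopology_subtopology Int_absorb1
        flip: subtopology_product_topology)
qed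

lemma compact_space_profile_space:
  assumes "\<And>\<nu>. \<nu> \<in> I \<Longrightarrow> compactin (powertop_real UNIV) (X \<nu>)"
  shows "compact_space (profile_space I X)"
  using assms by (simp add: profile_space_eq_product_topology compact_space_product_topology
      compact_space_subtopology)

lemma completely_regular_space_profile_space: "completely_regular_space (profile_space I X)"
  by (simp add: profile_space_def completely_regular_space_product_topology
      completely_regular_space_subtopology metrizable_imp_completely_regular_space
      metrizable_space_euclidean)

lemma continuous_map_into_profile_space:
  assumes "\<And>x. x \<in> topspace T \<Longrightarrow> f x \<in> PiE I X"
    and "\<And>\<nu> i. \<nu> \<in> I \<Longrightarrow> continuous_map T euclideanreal (\<lambda>x. f x \<nu> i)"
  shows "continuous_map T (profile_space I X) f"
  using assms unfolding profile_space_eq_product_topology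
  by (force simp: continuous_map_componentwise continuous_map_in_subtopology
      continuous_map_componentwise_UNIV PiE_iff)

lemma continuous_map_profile_space_coordinate:
  assumes "\<nu> \<in> I"
  shows "continuous_map (profile_space I X) euclideanreal (\<lambda>z. z \<nu> i)"
proof -
  have "continuous_map (profile_space I X) (powertop_real UNIV) (\<lambda>z. z \<nu>)"
    unfolding profile_space_def using assms
    by (intro continuous_map_from_subtopology continuous_map_product_coordinates)
  then show ?thesis
    by (simp add: continuous_map_componentwise_UNIV)
qed

definition bump_function :: "'a topology \<Rightarrow> 'a set \<Rightarrow> ('a \<Rightarrow> real) \<Rightarrow> bool" where
  "bump_function T U h \<longleftrightarrow> continuous_map T euclideanreal h \<and> (\<forall>z. 0 \<le> h z) \<and>
    (\<forall>z\<in>topspace T. 0 < h z \<longrightarrow> z \<in> U)"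

lemma completely_regular_space_bump_function:
  assumes "completely_regular_space T" "openin T U" "x \<in> U"
  obtains h where "bump_function T U h" "0 < h x"
proof -
  obtain f :: "'a \<Rightarrow> real"
    where f: "continuous_map T euclideanreal f" "f x = 0" "f ` (topspace T - U) \<subseteq> {1}"
    using assms unfolding completely_regular_space_alt' by metis
  have "continuous_map T euclideanreal (\<lambda>z. max 0 (1 - f z))"
    using f(1) by (intro continuous_intros) auto
  moreover have "z \<in> U" if "z \<in> topspace T" "0 < max 0 (1 - f z)" for z
    using f(3) that by (cases "z \<in> U") (auto simp: image_subset_iff)
  ultimately have "bump_function T U (\<lambda>z. max 0 (1 - f z))"
    by (simp add: bump_function_def)
  with f(2) that show thesis by simp
qed

lemma subordinate_bump_functions:
  assumes compact: "compact_space T" and regular: "completely_regular_space T"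
    and opn: "\<And>a. a \<in> L \<Longrightarrow> openin T (U a)" and cover: "topspace T \<subseteq> (\<Union>a\<in>L. U a)"
  obtains m :: nat and a and g :: "nat \<Rightarrow> 'a \<Rightarrow> real"
  where "\<And>k. k < m \<Longrightarrow> a k \<in> L" "\<And>k. k < m \<Longrightarrow> bump_function T (U (a k)) (g k)"
    and "\<And>x. x \<in> topspace T \<Longrightarrow> \<exists>k<m. 0 < g k x"
proof -
  have "\<exists>a h. a \<in> L \<and> bump_function T (U a) h \<and> 0 < h x" if x: "x \<in> topspace T" for x
  proof -
    obtain a where "a \<in> L" "x \<in> U a"
      using cover x by blast
    then show ?thesis
      using completely_regular_space_bump_function[OF regular opn] by metis
  qed
  then obtain a h where a: "\<And>x. x \<in> topspace T \<Longrightarrow> a x \<in> L"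
    and h: "\<And>x. x \<in> topspace T \<Longrightarrow> bump_function T (U (a x)) (h x)" "\<And>x. x \<in> topspace T \<Longrightarrow> 0 < h x x"
    by metis
  define W where "W x = {z \<in> topspace T. h x z \<in> {0<..}}" for x
  have "openin T (W x)" if "x \<in> topspace T" for x
    using h(1)[OF that] unfolding W_def
    by (intro openin_continuous_map_preimage[of _ euclideanreal]) (auto simp: bump_function_def)
  moreover have "topspace T \<subseteq> (\<Union>x\<in>topspace T. W x)"
    using h(2) by (auto simp: W_def)
  ultimately have "\<exists>F. finite F \<and> F \<subseteq> topspace T \<and> topspace T \<subseteq> (\<Union>x\<in>F. W x)"
    using compactinD[OF compact[unfolded compact_space_def], of "W ` topspace T"]
    by (force simp: ex_finite_subset_image)
  then obtain F where F: "finite F" "F \<subseteq> topspace T" "topspace T \<subseteq> (\<Union>x\<in>F. W x)"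
    by blast
  obtain e and m :: nat where e: "F = e ` {k. k < m}"
    using finite_imp_nat_seg_image_inj_on[OF F(1)] by blast
  then have "e k \<in> topspace T" if "k < m" for k
    using F(2) that by blast
  moreover have "\<exists>k<m. 0 < h (e k) x" if "x \<in> topspace T" for x
    using F(3) e that by (auto simp: W_def)
  ultimately show thesis
    using that[of m "\<lambda>k. a (e k)" "\<lambda>k. h (e k)"] a h(1) by blast
qed

subsection \<open>Nash's map\<close>

definition block :: "nat \<Rightarrow> (nat \<Rightarrow> 'i) \<Rightarrow> 'i \<Rightarrow> nat set" where
  "block m p \<nu> = {k. k < m \<and> p k = \<nu>}"

lemma finite_block [simp]: "finite (block m p \<nu>)"
  by (simp add: block_def)

definition capped_weights :: "nat \<Rightarrow> (nat \<Rightarrow> 'i) \<Rightarrow> vec set" where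
  "capped_weights m p = {l \<in> topspace (Euclidean_space m).
    (\<forall>k. 0 \<le> l k) \<and> (\<forall>\<nu>. (\<Sum>k\<in>block m p \<nu>. l k) \<le> 1)}"

lemma abs_capped_weights_le_1:
  assumes "l \<in> capped_weights m p"
  shows "\<bar>l k\<bar> \<le> 1"
proof (cases "k < m")
  case True
  then have "l k \<le> (\<Sum>j\<in>block m p (p k). l j)"
    using assms by (intro member_le_sum) (auto simp: block_def capped_weights_def)
  also have "\<dots> \<le> 1" using assms by (simp add: capped_weights_def)
  finally show ?thesis using assms by (simp add: capped_weights_def)
qed (use assms in \<open>auto simp: capped_weights_def topspace_Euclidean_space\<close>)

lemma Brouwer_capped_weights:
  fixes F :: "vec \<Rightarrow> vec"
  assumes cont: "continuous_map (subtopology (Euclidean_space m) (capped_weights m p))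
      (Euclidean_space m) F"
    and into: "\<And>l. l \<in> capped_weights m p \<Longrightarrow> F l \<in> capped_weights m p"
  obtains l where "l \<in> capped_weights m p" "F l = l"
proof -
  let ?E = "Euclidean_space m" and ?W = "capped_weights m p"
  define \<rho> :: "vec \<Rightarrow> vec" where
    "\<rho> l = (\<lambda>k. max 0 (l k) / max 1 (\<Sum>j\<in>block m p (p k). max 0 (l j)))" for l
  have \<rho>_mem: "\<rho> l \<in> ?W" if "l \<in> topspace ?E" for l
  proof -
    have "(\<Sum>k\<in>block m p \<nu>. \<rho> l k)
        = (\<Sum>k\<in>block m p \<nu>. max 0 (l k)) / max 1 (\<Sum>k\<in>block m p \<nu>. max 0 (l k))" for \<nu>
      unfolding sum_divide_distrib by (rule sum.cong) (auto simp: block_def \<rho>_def)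
    moreover have "s / max 1 s \<le> 1" for s :: real
      by (simp add: divide_le_eq_1 max_def)
    ultimately show ?thesis
      using that by (auto simp: capped_weights_def topspace_Euclidean_space \<rho>_def)
  qed
  have "continuous_map ?E ?E \<rho>"
    unfolding continuous_map_into_Euclidean_space \<rho>_def
    by (auto simp: topspace_Euclidean_space
        intro!: continuous_intros continuous_map_Euclidean_space_coordinate)
  then have "continuous_map ?E (subtopology ?E ?W) \<rho>"
    using \<rho>_mem by (auto simp: continuous_map_in_subtopology)
  then have "continuous_map ?E ?E (F \<circ> \<rho>)"
    using cont by (rule continuous_map_compose)
  then obtain l where l: "l \<in> topspace ?E" "F (\<rho> l) = l"
    using Brouwer_Euclidean_space[of m "F \<circ> \<rho>" 1] abs_capped_weights_le_1[OF into[OF \<rho>_mem]] by auto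
  then have "l \<in> ?W"
    using into \<rho>_mem by metis
  moreover from this have "\<rho> l = l"
    by (simp add: capped_weights_def \<rho>_def fun_eq_iff max_absorb1 max_absorb2)
  ultimately show thesis
    using that l(2) by metis
qed

definition nash_map :: "nat \<Rightarrow> (nat \<Rightarrow> 'i) \<Rightarrow> (nat \<Rightarrow> real) \<Rightarrow> vec \<Rightarrow> vec" where
  "nash_map m p g l = (\<lambda>k. if k < m then (l k + g k) / (1 + (\<Sum>j\<in>block m p (p k). g j)) else 0)"

lemma nash_map_in_capped_weights:
  assumes l: "l \<in> capped_weights m p" and g: "\<And>k. k < m \<Longrightarrow> 0 \<le> g k"
  shows "nash_map m p g l \<in> capped_weights m p"
proof -
  have "(\<Sum>k\<in>block m p \<nu>. nash_map m p g l k) \<le> 1" for \<nu>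
  proof -
    let ?G = "\<Sum>k\<in>block m p \<nu>. g k"
    have "(\<Sum>k\<in>block m p \<nu>. nash_map m p g l k) = (\<Sum>k\<in>block m p \<nu>. (l k + g k) / (1 + ?G))"
      by (rule sum.cong) (auto simp: block_def nash_map_def)
    also have "\<dots> = ((\<Sum>k\<in>block m p \<nu>. l k) + ?G) / (1 + ?G)"
      by (simp add: sum.distrib flip: sum_divide_distrib)
    also have "\<dots> \<le> 1"
      using l sum_nonneg[of "block m p \<nu>" g] g by (simp add: block_def divide_le_eq_1 capped_weights_def)
    finally show ?thesis .
  qed
  then show ?thesis
    using l g by (auto simp: capped_weights_def nash_map_def block_def topspace_Euclidean_space
        intro!: divide_nonneg_nonneg add_nonneg_nonneg sum_nonneg)
qed

lemma nash_map_fixpoint: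
  assumes "nash_map m p g l = l" and g: "\<And>k. k < m \<Longrightarrow> 0 \<le> g k" and "k < m"
  shows "l k * (\<Sum>j\<in>block m p (p k). g j) = g k"
proof -
  have "0 \<le> (\<Sum>j\<in>block m p (p k). g j)"
    using g by (auto simp: block_def intro: sum_nonneg)
  then have "l k * (1 + (\<Sum>j\<in>block m p (p k). g j)) = l k + g k"
    using fun_cong[OF assms(1), of k] \<open>k < m\<close> by (simp add: nash_map_def field_simps)
  then show ?thesis by (simp add: algebra_simps)
qed

lemma continuous_map_nash_map:
  assumes l: "\<And>k. continuous_map T euclideanreal (\<lambda>x. l x k)"
    and g: "\<And>k. k < m \<Longrightarrow> continuous_map T euclideanreal (g k)" and g_nonneg: "\<And>k x. k < m \<Longrightarrow> 0 \<le> g k x"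
  shows "continuous_map T (Euclidean_space m) (\<lambda>x. nash_map m p (\<lambda>k. g k x) (l x))"
proof -
  have "continuous_map T euclideanreal (\<lambda>x. nash_map m p (\<lambda>k. g k x) (l x) k)" for k
  proof (cases "k < m")
    case True
    have "0 < 1 + (\<Sum>j\<in>block m p (p k). g j x)" for x
      using g_nonneg by (auto simp: block_def intro!: add_pos_nonneg sum_nonneg)
    note less_imp_neq[OF this, symmetric]
    then have "continuous_map T euclideanreal (\<lambda>x. (l x k + g k x) / (1 + (\<Sum>j\<in>block m p (p k). g j x)))"
      using True by (intro continuous_intros l g) (auto simp: block_def)
    with True show ?thesis by (simp add: nash_map_def)
  qed (simp add: nash_map_def)
  then show ?thesis
    by (simp add: continuous_map_into_Euclidean_space nash_map_def)
qed

definition mixed_profile ::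
  "'i set \<Rightarrow> nat \<Rightarrow> (nat \<Rightarrow> 'i) \<Rightarrow> (nat \<Rightarrow> vec) \<Rightarrow> ('i \<Rightarrow> vec) \<Rightarrow> vec \<Rightarrow> 'i \<Rightarrow> vec" where
  "mixed_profile I m p y x l = (\<lambda>\<nu>\<in>I. \<lambda>i.
    (1 - (\<Sum>k\<in>block m p \<nu>. l k)) * x \<nu> i + (\<Sum>k\<in>block m p \<nu>. l k * y k i))"

lemma mixed_profile_in_PiE:
  assumes "\<And>\<nu>. \<nu> \<in> I \<Longrightarrow> fconvex (X \<nu>)" "\<And>\<nu>. \<nu> \<in> I \<Longrightarrow> x \<nu> \<in> X \<nu>" "\<And>k. k < m \<Longrightarrow> y k \<in> X (p k)"
    and "l \<in> capped_weights m p"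
  shows "mixed_profile I m p y x l \<in> PiE I X"
  using assms unfolding mixed_profile_def
  by (auto simp: capped_weights_def block_def intro!: fconvex_subconvex_combination)

lemma continuous_map_mixed_profile:
  assumes "\<And>\<nu>. \<nu> \<in> I \<Longrightarrow> fconvex (X \<nu>)" "\<And>\<nu>. \<nu> \<in> I \<Longrightarrow> x \<nu> \<in> X \<nu>" "\<And>k. k < m \<Longrightarrow> y k \<in> X (p k)"
  shows "continuous_map (subtopology (Euclidean_space m) (capped_weights m p)) (profile_space I X)
    (mixed_profile I m p y x)"
proof (rule continuous_map_into_profile_space)
  show "mixed_profile I m p y x l \<in> PiE I X"
    if "l \<in> topspace (subtopology (Euclidean_space m) (capped_weights m p))" for l
    using mixed_profile_in_PiE[of I X x m y p, OF assms] that by simp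
  show "continuous_map (subtopology (Euclidean_space m) (capped_weights m p)) euclideanreal
      (\<lambda>l. mixed_profile I m p y x l \<nu> i)" if "\<nu> \<in> I" for \<nu> i
    using that by (auto simp: mixed_profile_def intro!: continuous_intros
        continuous_map_from_subtopology continuous_map_Euclidean_space_coordinate)
qed

lemma mixed_profile_nash_map_fixpoint:
  assumes fixpoint: "nash_map m p g l = l" and g: "\<And>k. k < m \<Longrightarrow> 0 \<le> g k" and "\<nu> \<in> I"
  shows "(\<Sum>k\<in>block m p \<nu>. g k) * mixed_profile I m p y x l \<nu> i = (\<Sum>k\<in>block m p \<nu>. g k * y k i)"
proof -
  define G where "G = (\<Sum>k\<in>block m p \<nu>. g k)"
  have balance: "G * l k = g k" if "k \<in> block m p \<nu>" for k
    using nash_map_fixpoint[OF fixpoint g] that by (auto simp: G_def block_def mult.commute)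
  have "G * (\<Sum>k\<in>block m p \<nu>. l k) = G"
    using balance by (simp add: sum_distrib_left) (simp add: G_def)
  moreover have "G * (\<Sum>k\<in>block m p \<nu>. l k * y k i) = (\<Sum>k\<in>block m p \<nu>. g k * y k i)"
    using balance by (simp add: sum_distrib_left flip: mult.assoc)
  moreover have "G * mixed_profile I m p y x l \<nu> i
      = (G - G * (\<Sum>k\<in>block m p \<nu>. l k)) * x \<nu> i + G * (\<Sum>k\<in>block m p \<nu>. l k * y k i)"
    using \<open>\<nu> \<in> I\<close> by (simp add: mixed_profile_def algebra_simps)
  ultimately show ?thesis
    by (simp add: G_def)
qed

lemma weighted_average_profile_exists:
  fixes p :: "nat \<Rightarrow> 'i" and y :: "nat \<Rightarrow> vec" and g :: "nat \<Rightarrow> ('i \<Rightarrow> vec) \<Rightarrow> real"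
  assumes X: "\<And>\<nu>. \<nu> \<in> I \<Longrightarrow> fconvex (X \<nu>)" "\<And>\<nu>. \<nu> \<in> I \<Longrightarrow> X \<nu> \<noteq> {}"
    and y: "\<And>k. k < m \<Longrightarrow> y k \<in> X (p k)"
    and g: "\<And>k. k < m \<Longrightarrow> continuous_map (profile_space I X) euclideanreal (g k)"
    and g_nonneg: "\<And>k z. k < m \<Longrightarrow> 0 \<le> g k z"
  shows "\<exists>z\<in>PiE I X. \<forall>\<nu>\<in>I. \<forall>i.
    (\<Sum>k\<in>block m p \<nu>. g k z) * z \<nu> i = (\<Sum>k\<in>block m p \<nu>. g k z * y k i)"
proof -
  let ?W = "subtopology (Euclidean_space m) (capped_weights m p)"
  have "\<forall>\<nu>\<in>I. \<exists>v. v \<in> X \<nu>"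
    using X(2) by blast
  then obtain x where x: "\<And>\<nu>. \<nu> \<in> I \<Longrightarrow> x \<nu> \<in> X \<nu>"
    by metis
  let ?z = "mixed_profile I m p y x"
  have "continuous_map ?W euclideanreal (\<lambda>l. g k (?z l))" if "k < m" for k
    using continuous_map_compose[OF continuous_map_mixed_profile[of I X x m y p, OF X(1) x y] g[OF that]]
    by (simp add: o_def)
  then have "continuous_map ?W (Euclidean_space m) (\<lambda>l. nash_map m p (\<lambda>k. g k (?z l)) l)"
    using g_nonneg by (intro continuous_map_nash_map)
      (auto intro: continuous_map_from_subtopology continuous_map_Euclidean_space_coordinate)
  then obtain l where l: "l \<in> capped_weights m p" and fixpoint: "nash_map m p (\<lambda>k. g k (?z l)) l = l"
    by (rule Brouwer_capped_weights) (auto intro: nash_map_in_capped_weights g_nonneg)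
  have "?z l \<in> PiE I X"
    using mixed_profile_in_PiE[of I X x m y p, OF X(1) x y l] .
  then show ?thesis
    using mixed_profile_nash_map_fixpoint[OF fixpoint g_nonneg] by blast
qed

theorem maximal_profile_exists:
  assumes X_compact: "\<And>\<nu>. \<nu> \<in> I \<Longrightarrow> compactin (powertop_real UNIV) (X \<nu>)"
    and X_convex: "\<And>\<nu>. \<nu> \<in> I \<Longrightarrow> fconvex (X \<nu>)" and X_nonempty: "\<And>\<nu>. \<nu> \<in> I \<Longrightarrow> X \<nu> \<noteq> {}"
    and P_subset: "\<And>\<nu> z. \<nu> \<in> I \<Longrightarrow> z \<in> PiE I X \<Longrightarrow> P \<nu> z \<subseteq> X \<nu>"
    and P_convex: "\<And>\<nu> z. \<nu> \<in> I \<Longrightarrow> z \<in> PiE I X \<Longrightarrow> fconvex (P \<nu> z)"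
    and P_irrefl: "\<And>\<nu> z. \<nu> \<in> I \<Longrightarrow> z \<in> PiE I X \<Longrightarrow> z \<nu> \<notin> P \<nu> z"
    and P_open: "\<And>\<nu> y. \<nu> \<in> I \<Longrightarrow> y \<in> X \<nu> \<Longrightarrow> openin (profile_space I X) {z \<in> PiE I X. y \<in> P \<nu> z}"
  shows "\<exists>z\<in>PiE I X. \<forall>\<nu>\<in>I. P \<nu> z = {}"
proof (rule ccontr)
  assume "\<not> ?thesis"
  then have cover: "topspace (profile_space I X) \<subseteq> (\<Union>a\<in>Sigma I X. {z \<in> PiE I X. snd a \<in> P (fst a) z})"
    using P_subset by fastforce
  have lower_sections: "openin (profile_space I X) {z \<in> PiE I X. snd a \<in> P (fst a) z}"
    if "a \<in> Sigma I X" for a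
    using P_open that by auto
  obtain m :: nat and a g where a: "\<And>k. k < m \<Longrightarrow> a k \<in> Sigma I X"
    and g: "\<And>k. k < m \<Longrightarrow>
      bump_function (profile_space I X) {z \<in> PiE I X. snd (a k) \<in> P (fst (a k)) z} (g k)"
    and positive: "\<And>z. z \<in> PiE I X \<Longrightarrow> \<exists>k<m. 0 < g k z"
    by (rule subordinate_bump_functions[OF compact_space_profile_space[OF X_compact]
          completely_regular_space_profile_space lower_sections cover]) auto
  have targets: "snd (a k) \<in> X (fst (a k))" if "k < m" for k
    using a[OF that] by auto
  have g_continuous: "continuous_map (profile_space I X) euclideanreal (g k)"
    and g_nonneg: "0 \<le> g k z" if "k < m" for k z
    using g[OF that] by (auto simp: bump_function_def)
  define J where "J = block m (\<lambda>k. fst (a k))"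
  obtain z where z: "z \<in> PiE I X" and average: "\<And>\<nu> i. \<nu> \<in> I \<Longrightarrow>
      (\<Sum>k\<in>J \<nu>. g k z) * z \<nu> i = (\<Sum>k\<in>J \<nu>. g k z * snd (a k) i)"
    using weighted_average_profile_exists[of I X m "\<lambda>k. snd (a k)" "\<lambda>k. fst (a k)" g,
        OF X_convex X_nonempty targets g_continuous g_nonneg] unfolding J_def by blast
  obtain k where k: "k < m" "0 < g k z"
    using positive[OF z] by blast
  define \<nu> where "\<nu> = fst (a k)"
  have "\<nu> \<in> I" using a[OF k(1)] by (auto simp: \<nu>_def)
  have "z \<nu> \<in> P \<nu> z"
  proof (rule mem_fconvex_if_weighted_average)
    show "0 < (\<Sum>k\<in>J \<nu>. g k z)"
      using k g by (intro sum_pos2[of _ k]) (auto simp: J_def block_def \<nu>_def bump_function_def)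
  qed (use P_convex average g z \<open>\<nu> \<in> I\<close> in \<open>auto simp: J_def block_def bump_function_def\<close>)
  then show False
    using P_irrefl[OF \<open>\<nu> \<in> I\<close> z] by blast
qed

subsection \<open>Abstract economies\<close>

lemma compact_space_eventually_ball:
  assumes "compact_space T"
    and local: "\<And>x. x \<in> topspace T \<Longrightarrow> \<exists>U. openin T U \<and> x \<in> U \<and> (\<forall>\<^sub>F e in F. \<forall>z\<in>U. Q e z)"
  shows "\<forall>\<^sub>F e in F. \<forall>z\<in>topspace T. Q e z"
proof -
  obtain U where U: "\<And>x. x \<in> topspace T \<Longrightarrow> openin T (U x) \<and> x \<in> U x"
    "\<And>x. x \<in> topspace T \<Longrightarrow> \<forall>\<^sub>F e in F. \<forall>z\<in>U x. Q e z"
    using local by metis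
  have "\<exists>\<F>. finite \<F> \<and> \<F> \<subseteq> U ` topspace T \<and> topspace T \<subseteq> \<Union>\<F>"
    using assms(1)[unfolded compact_space_alt, rule_format, of "U ` topspace T"] U(1) by blast
  then obtain S where S: "finite S" "S \<subseteq> topspace T" "topspace T \<subseteq> (\<Union>x\<in>S. U x)"
    by (metis finite_subset_image)
  have "\<forall>\<^sub>F e in F. \<forall>x\<in>S. \<forall>z\<in>U x. Q e z"
    using S(1,2) U(2) by (intro eventually_ball_finite) auto
  then show ?thesis
    by (rule eventually_mono) (use S(3) in blast)
qed

locale abstract_economy =
  fixes I :: "'i set" and n :: "'i \<Rightarrow> nat" and X :: "'i \<Rightarrow> vec set"
    and C P :: "'i \<Rightarrow> ('i \<Rightarrow> vec) \<Rightarrow> vec set"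
  assumes X_compact: "\<nu> \<in> I \<Longrightarrow> compactin (Euclidean_space (n \<nu>)) (X \<nu>)"
    and X_convex: "\<nu> \<in> I \<Longrightarrow> fconvex (X \<nu>)"
    and X_nonempty: "\<nu> \<in> I \<Longrightarrow> X \<nu> \<noteq> {}"
    and C_hcont: "\<nu> \<in> I \<Longrightarrow> hcont (profile_space I X) (Euclidean_space (n \<nu>)) (C \<nu>)"
    and C_subset: "\<nu> \<in> I \<Longrightarrow> z \<in> PiE I X \<Longrightarrow> C \<nu> z \<subseteq> X \<nu>"
    and C_nonempty: "\<nu> \<in> I \<Longrightarrow> z \<in> PiE I X \<Longrightarrow> C \<nu> z \<noteq> {}"
    and C_closed: "\<nu> \<in> I \<Longrightarrow> z \<in> PiE I X \<Longrightarrow> closedin (Euclidean_space (n \<nu>)) (C \<nu> z)"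
    and C_convex: "\<nu> \<in> I \<Longrightarrow> z \<in> PiE I X \<Longrightarrow> fconvex (C \<nu> z)"
    and P_open: "\<nu> \<in> I \<Longrightarrow>
      openin (prod_topology (profile_space I X) (Euclidean_space (n \<nu>))) (SIGMA z:PiE I X. P \<nu> z)"
    and P_convex: "\<nu> \<in> I \<Longrightarrow> z \<in> PiE I X \<Longrightarrow> fconvex (P \<nu> z)"
    and P_irrefl: "\<nu> \<in> I \<Longrightarrow> z \<in> PiE I X \<Longrightarrow> z \<nu> \<notin> P \<nu> z"
begin

lemma X_subset: "\<nu> \<in> I \<Longrightarrow> X \<nu> \<subseteq> topspace (Euclidean_space (n \<nu>))"
  using X_compact by (rule compactin_subset_topspace)

lemma X_compact_powertop: "\<nu> \<in> I \<Longrightarrow> compactin (powertop_real UNIV) (X \<nu>)"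
  using X_compact by (auto simp: Euclidean_space_def compactin_subtopology)

lemma openin_C_hits:
  "\<nu> \<in> I \<Longrightarrow> openin (Euclidean_space (n \<nu>)) V \<Longrightarrow>
    openin (profile_space I X) {z \<in> PiE I X. C \<nu> z \<inter> V \<noteq> {}}"
  using C_hcont by (simp add: hcont_iff_openin lhc_iff_openin)

lemma openin_C_subset:
  "\<nu> \<in> I \<Longrightarrow> openin (Euclidean_space (n \<nu>)) V \<Longrightarrow>
    openin (profile_space I X) {z \<in> PiE I X. C \<nu> z \<subseteq> V}"
  using C_hcont by (simp add: hcont_iff_openin)

lemma openin_P_lower_section:
  assumes "\<nu> \<in> I" "y \<in> X \<nu>"
  shows "openin (profile_space I X) {z \<in> PiE I X. y \<in> P \<nu> z}"
proof -
  have "y \<in> topspace (Euclidean_space (n \<nu>))"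
    using X_subset assms by blast
  then have "continuous_map (profile_space I X)
      (prod_topology (profile_space I X) (Euclidean_space (n \<nu>))) (\<lambda>z. (z, y))"
    by (simp add: continuous_map_pairedI)
  from openin_continuous_map_preimage[OF this P_open[OF assms(1)]] show ?thesis
    by (simp cong: conj_cong)
qed

text \<open>The interior is taken because the lower sections of \<open>liked_actions\<close> have to be open.\<close>

definition infeasible :: "real \<Rightarrow> 'i \<Rightarrow> ('i \<Rightarrow> vec) set" where
  "infeasible e \<nu> = profile_space I X interior_of {z \<in> PiE I X. z \<nu> \<notin> cube_neighbourhood e (C \<nu> z)}"

lemma infeasibleD: "z \<in> infeasible e \<nu> \<Longrightarrow> z \<nu> \<notin> cube_neighbourhood e (C \<nu> z)"
  unfolding infeasible_def
  using interior_of_subset[of "profile_space I X"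
      "{z \<in> PiE I X. z \<nu> \<notin> cube_neighbourhood e (C \<nu> z)}"] by blast

definition liked_actions :: "real \<Rightarrow> 'i \<Rightarrow> ('i \<Rightarrow> vec) \<Rightarrow> vec set" where
  "liked_actions e \<nu> z = X \<nu> \<inter> cube_neighbourhood e (C \<nu> z) \<inter>
    (if z \<in> infeasible e \<nu> then UNIV else P \<nu> z)"

lemma fconvex_liked_actions: "\<nu> \<in> I \<Longrightarrow> z \<in> PiE I X \<Longrightarrow> fconvex (liked_actions e \<nu> z)"
  unfolding liked_actions_def
  by (auto intro!: fconvex_Int X_convex fconvex_cube_neighbourhood C_convex P_convex)

lemma own_action_not_liked: "\<nu> \<in> I \<Longrightarrow> z \<in> PiE I X \<Longrightarrow> z \<nu> \<notin> liked_actions e \<nu> z"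
  using P_irrefl[of \<nu> z] infeasibleD[of z e \<nu>] by (auto simp: liked_actions_def)

lemma openin_liked_actions_lower_section:
  assumes \<nu>: "\<nu> \<in> I" and y: "y \<in> X \<nu>" and "0 < e"
  shows "openin (profile_space I X) {z \<in> PiE I X. y \<in> liked_actions e \<nu> z}"
proof -
  let ?V = "topspace (Euclidean_space (n \<nu>)) \<inter> cube e y"
  have "openin (profile_space I X)
      ({z \<in> PiE I X. C \<nu> z \<inter> ?V \<noteq> {}} \<inter> (infeasible e \<nu> \<union> {z \<in> PiE I X. y \<in> P \<nu> z}))"
    unfolding infeasible_def using \<nu> y X_subset \<open>0 < e\<close>
    by (intro openin_Int openin_Un openin_C_hits openin_P_lower_section openin_Euclidean_space_cube
        openin_interior_of) auto
  moreover have "C \<nu> z \<inter> ?V \<noteq> {} \<longleftrightarrow> y \<in> cube_neighbourhood e (C \<nu> z)" if "z \<in> PiE I X" for z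
    using C_subset[OF \<nu> that] X_subset[OF \<nu>] by (auto simp: cube_neighbourhood_def cube_commute)
  then have "{z \<in> PiE I X. y \<in> liked_actions e \<nu> z}
      = {z \<in> PiE I X. C \<nu> z \<inter> ?V \<noteq> {}} \<inter> (infeasible e \<nu> \<union> {z \<in> PiE I X. y \<in> P \<nu> z})"
    using y by (auto simp: liked_actions_def)
  ultimately show ?thesis by simp
qed

lemma no_liked_actions_profile_exists:
  assumes "0 < e"
  shows "\<exists>z\<in>PiE I X. \<forall>\<nu>\<in>I. liked_actions e \<nu> z = {}"
proof (rule maximal_profile_exists)
  show "liked_actions e \<nu> z \<subseteq> X \<nu>" for \<nu> z
    by (auto simp: liked_actions_def)
qed (auto intro: X_compact_powertop X_convex fconvex_liked_actions openin_liked_actions_lower_section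
    assms simp: X_nonempty own_action_not_liked)

lemma liked_actions_nonempty:
  assumes "0 < e" "\<nu> \<in> I" "z \<in> PiE I X" and "z \<in> infeasible e \<nu> \<or> C \<nu> z \<inter> P \<nu> z \<noteq> {}"
  shows "liked_actions e \<nu> z \<noteq> {}"
proof -
  have "C \<nu> z \<subseteq> X \<nu> \<inter> cube_neighbourhood e (C \<nu> z)"
    using C_subset[OF assms(2,3)] subset_cube_neighbourhood[OF \<open>0 < e\<close>] by simp
  then show ?thesis
    using assms(4) C_nonempty[OF assms(2,3)] unfolding liked_actions_def by fastforce
qed

lemma openin_close_profiles:
  assumes \<nu>: "\<nu> \<in> I" and z: "z \<in> PiE I X" and "0 < d"
  shows "openin (profile_space I X)
    {w \<in> PiE I X. w \<nu> \<in> cube d (z \<nu>) \<and> C \<nu> w \<subseteq> cube_neighbourhood d (C \<nu> z)}"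
proof -
  let ?E = "Euclidean_space (n \<nu>)"
  have C_E: "C \<nu> w \<subseteq> topspace ?E" if "w \<in> PiE I X" for w
    using C_subset[OF \<nu> that] X_subset[OF \<nu>] by blast
  have profile_E: "w \<nu> \<in> topspace ?E" if "w \<in> PiE I X" for w
    using that \<nu> X_subset by auto
  have "continuous_map (profile_space I X) ?E (\<lambda>w. w \<nu>)"
    using X_subset[OF \<nu>] \<nu> by (auto simp: continuous_map_into_Euclidean_space
        topspace_Euclidean_space subset_iff PiE_iff intro: continuous_map_profile_space_coordinate)
  then have "openin (profile_space I X)
      {w \<in> topspace (profile_space I X). w \<nu> \<in> topspace ?E \<inter> cube d (z \<nu>)}" (is "openin _ ?U")
    using openin_Euclidean_space_cube[OF profile_E[OF z] \<open>0 < d\<close>]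
    by (rule openin_continuous_map_preimage)
  moreover have "openin (profile_space I X)
      {w \<in> PiE I X. C \<nu> w \<subseteq> topspace ?E \<inter> cube_neighbourhood d (C \<nu> z)}" (is "openin _ ?V")
    using openin_Euclidean_space_cube_neighbourhood[OF C_E[OF z] \<open>0 < d\<close>]
    by (rule openin_C_subset[OF \<nu>])
  ultimately have "openin (profile_space I X) (?U \<inter> ?V)"
    by (rule openin_Int)
  moreover have "?U \<inter> ?V
      = {w \<in> PiE I X. w \<nu> \<in> cube d (z \<nu>) \<and> C \<nu> w \<subseteq> cube_neighbourhood d (C \<nu> z)}"
    using C_E profile_E by auto
  ultimately show ?thesis by simp
qed

lemma infeasible_neighbourhood:
  assumes \<nu>: "\<nu> \<in> I" and z: "z \<in> PiE I X" and "z \<nu> \<notin> C \<nu> z"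
  shows "\<exists>U. openin (profile_space I X) U \<and> z \<in> U \<and> (\<forall>\<^sub>F e in at_right 0. U \<subseteq> infeasible e \<nu>)"
proof -
  let ?E = "topspace (Euclidean_space (n \<nu>))"
  have "z \<nu> \<in> ?E - C \<nu> z"
    using z \<nu> X_subset assms(3) by auto
  then obtain r where "0 < r" and r: "?E \<inter> cube r (z \<nu>) \<subseteq> ?E - C \<nu> z"
    using openin_Euclidean_space_contains_cube[OF _ \<open>z \<nu> \<in> ?E - C \<nu> z\<close>] C_closed[OF \<nu> z]
    by (auto simp: closedin_def)
  then have disjoint: "C \<nu> z \<inter> cube r (z \<nu>) = {}"
    using C_subset[OF \<nu> z] X_subset[OF \<nu>] by blast
  define d where "d = r / 3"
  have "0 < d" using \<open>0 < r\<close> by (simp add: d_def)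
  define U where "U = {w \<in> PiE I X. w \<nu> \<in> cube d (z \<nu>) \<and> C \<nu> w \<subseteq> cube_neighbourhood d (C \<nu> z)}"
  have "openin (profile_space I X) U"
    unfolding U_def by (rule openin_close_profiles[OF \<nu> z \<open>0 < d\<close>])
  moreover have "z \<in> U"
    using z subset_cube_neighbourhood \<open>0 < d\<close> by (auto simp: U_def centre_in_cube)
  moreover have "U \<subseteq> infeasible e \<nu>" if "e \<le> d" for e
  proof -
    have "w \<nu> \<notin> cube_neighbourhood e (C \<nu> w)" if "w \<in> U" for w
      using not_mem_cube_neighbourhood_if_close[of "C \<nu> z" d "z \<nu>" "w \<nu>" "C \<nu> w" e] disjoint that \<open>e \<le> d\<close>
      by (simp add: U_def d_def)
    then have "U \<subseteq> {w \<in> PiE I X. w \<nu> \<notin> cube_neighbourhood e (C \<nu> w)}"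
      by (auto simp: U_def)
    then show ?thesis
      unfolding infeasible_def using \<open>openin (profile_space I X) U\<close> by (rule interior_of_maximal)
  qed
  then have "\<forall>\<^sub>F e in at_right 0. U \<subseteq> infeasible e \<nu>"
    unfolding eventually_at_right_field using \<open>0 < d\<close> by (intro exI[of _ d]) auto
  ultimately show ?thesis by blast
qed

lemma profitable_deviation_neighbourhood:
  assumes \<nu>: "\<nu> \<in> I" and z: "z \<in> PiE I X" and y: "y \<in> C \<nu> z" "y \<in> P \<nu> z"
  shows "\<exists>U. openin (profile_space I X) U \<and> z \<in> U \<and> (\<forall>w\<in>U. C \<nu> w \<inter> P \<nu> w \<noteq> {})"
proof -
  obtain W V where W: "openin (profile_space I X) W" "z \<in> W"
    and V: "openin (Euclidean_space (n \<nu>)) V" "y \<in> V"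
    and WV: "W \<times> V \<subseteq> (SIGMA z:PiE I X. P \<nu> z)"
    using P_open[OF \<nu>, unfolded openin_prod_topology_alt, rule_format, of z y] z y(2) by blast
  let ?U = "W \<inter> {w \<in> PiE I X. C \<nu> w \<inter> V \<noteq> {}}"
  have "openin (profile_space I X) ?U"
    by (rule openin_Int[OF W(1) openin_C_hits[OF \<nu> V(1)]])
  moreover have "z \<in> ?U"
    using W(2) V(2) z y(1) by blast
  moreover have "\<forall>w\<in>?U. C \<nu> w \<inter> P \<nu> w \<noteq> {}"
    using WV by blast
  ultimately show ?thesis by blast
qed

lemma liked_actions_nonempty_neighbourhood:
  assumes z: "z \<in> PiE I X" and "\<not> (\<forall>\<nu>\<in>I. z \<nu> \<in> C \<nu> z \<and> C \<nu> z \<inter> P \<nu> z = {})"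
  shows "\<exists>U. openin (profile_space I X) U \<and> z \<in> U \<and>
    (\<forall>\<^sub>F e in at_right 0. \<forall>w\<in>U. \<exists>\<nu>\<in>I. liked_actions e \<nu> w \<noteq> {})"
proof -
  obtain \<nu> where \<nu>: "\<nu> \<in> I" and no_equilibrium: "\<not> (z \<nu> \<in> C \<nu> z \<and> C \<nu> z \<inter> P \<nu> z = {})"
    using assms(2) by blast
  obtain U where U: "openin (profile_space I X) U" "z \<in> U"
    and near: "\<forall>\<^sub>F e in at_right 0. \<forall>w\<in>U. w \<in> infeasible e \<nu> \<or> C \<nu> w \<inter> P \<nu> w \<noteq> {}"
  proof (cases "z \<nu> \<in> C \<nu> z")
    case False
    then obtain U where U: "openin (profile_space I X) U" "z \<in> U"
      and "\<forall>\<^sub>F e in at_right 0. U \<subseteq> infeasible e \<nu>"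
      using infeasible_neighbourhood[OF \<nu> z] by blast
    from this(3) have "\<forall>\<^sub>F e in at_right 0. \<forall>w\<in>U. w \<in> infeasible e \<nu> \<or> C \<nu> w \<inter> P \<nu> w \<noteq> {}"
      by (rule eventually_mono) blast
    with U show thesis by (rule that)
  next
    case True
    then obtain y where "y \<in> C \<nu> z" "y \<in> P \<nu> z"
      using no_equilibrium by blast
    then obtain U where "openin (profile_space I X) U" "z \<in> U" "\<forall>w\<in>U. C \<nu> w \<inter> P \<nu> w \<noteq> {}"
      using profitable_deviation_neighbourhood[OF \<nu> z] by blast
    then show thesis
      by (intro that[of U] always_eventually) auto
  qed
  have "U \<subseteq> PiE I X"
    using openin_subset[OF U(1)] by simp
  have "\<forall>\<^sub>F e in at_right 0. \<forall>w\<in>U. \<exists>\<nu>\<in>I. liked_actions e \<nu> w \<noteq> {}"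
    using near eventually_at_right_less[of 0]
    by eventually_elim (use \<open>U \<subseteq> PiE I X\<close> \<nu> liked_actions_nonempty[OF _ \<nu>] in blast)
  with U show ?thesis by blast
qed

theorem equilibrium_exists: "\<exists>z\<in>PiE I X. \<forall>\<nu>\<in>I. z \<nu> \<in> C \<nu> z \<and> C \<nu> z \<inter> P \<nu> z = {}"
proof (rule ccontr)
  assume "\<not> ?thesis"
  then have "\<exists>U. openin (profile_space I X) U \<and> z \<in> U \<and>
      (\<forall>\<^sub>F e in at_right 0. \<forall>w\<in>U. \<exists>\<nu>\<in>I. liked_actions e \<nu> w \<noteq> {})" if "z \<in> PiE I X" for z
    using liked_actions_nonempty_neighbourhood[OF that] that by blast
  then have "\<forall>\<^sub>F e in at_right 0. \<forall>z\<in>topspace (profile_space I X). \<exists>\<nu>\<in>I. liked_actions e \<nu> z \<noteq> {}"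
    by (intro compact_space_eventually_ball compact_space_profile_space X_compact_powertop) auto
  then have "\<forall>\<^sub>F e in at_right (0::real). False"
    using eventually_at_right_less[of 0]
    by eventually_elim (use no_liked_actions_profile_exists in force)
  then show False
    by simp
qed

end

subsection \<open>Generalized games\<close>

lemma PiE_subset_topspace_prof_top:
  assumes "\<And>\<nu>. \<nu> \<in> I \<Longrightarrow> X \<nu> \<subseteq> topspace (Euclidean_space (n \<nu>))"
  shows "PiE I X \<subseteq> topspace (prof_top I n)"
  using assms by (simp add: prof_top_def PiE_mono)

lemma continuous_map_restrict_profile_space:
  assumes "J \<subseteq> I"
  shows "continuous_map (profile_space I X) (profile_space J X) (\<lambda>z. restrict z J)"
  using assms by (intro continuous_map_into_profile_space)
    (auto simp: PiE_iff subset_iff intro: continuous_map_profile_space_coordinate)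

lemma hcont_restrict_profile_space:
  assumes X: "\<And>\<nu>. \<nu> \<in> I \<Longrightarrow> X \<nu> \<subseteq> topspace (Euclidean_space (n \<nu>))" and "J \<subseteq> I"
    and F: "hcont (subtopology (product_topology (\<lambda>\<nu>. Euclidean_space (n \<nu>)) J) (PiE J X)) S F"
  shows "hcont (profile_space I X) S (\<lambda>z. F (restrict z J))"
proof -
  have "hcont (profile_space J X) S F"
    using F X \<open>J \<subseteq> I\<close> by (simp add: subtopology_product_Euclidean_space subset_iff)
  then show ?thesis
    using continuous_map_restrict_profile_space[OF \<open>J \<subseteq> I\<close>] by (rule hcont_compose)
qed

lemma openin_graph_profile_space:
  assumes X: "\<And>\<nu>. \<nu> \<in> I \<Longrightarrow> X \<nu> \<subseteq> topspace (Euclidean_space (n \<nu>))"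
    and F: "lhc (prof_top I n) (Euclidean_space k) F"
    and "\<And>x. x \<in> topspace (prof_top I n) \<Longrightarrow> fconvex (F x) \<and> openin (Euclidean_space k) (F x)"
  shows "openin (prod_topology (profile_space I X) (Euclidean_space k)) (SIGMA z:PiE I X. F z)"
proof -
  have subspace: "profile_space I X = subtopology (prof_top I n) (PiE I X)"
    using subtopology_product_Euclidean_space[of I X n, OF X] by (simp add: prof_top_def)
  have "lhc (profile_space I X) (Euclidean_space k) F"
    using lhc_compose[OF F continuous_map_from_subtopology[OF continuous_map_id]] by (simp add: subspace)
  then show ?thesis
    using openin_graph_of_lhc_open_fconvex[of "profile_space I X" k F]
      PiE_subset_topspace_prof_top[of I X n, OF X] assms(3) by (auto simp: subset_iff)
qed

lemma is_GNEI:
  assumes "z \<in> PiE I X" and "\<And>\<nu>. \<nu> \<in> I \<Longrightarrow> z \<nu> \<in> K \<nu> (restrict z (I - {\<nu>}))"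
    and "\<And>\<nu>. \<nu> \<in> I \<Longrightarrow> K \<nu> (restrict z (I - {\<nu>})) \<subseteq> topspace (Euclidean_space (n \<nu>))"
    and "\<And>\<nu>. \<nu> \<in> I \<Longrightarrow> K \<nu> (restrict z (I - {\<nu>})) \<inter> Us n R \<nu> z = {}"
  shows "is_GNE I X R K z"
  using assms unfolding is_GNE_def Us_def by fast

theorem theorem3:
  fixes I :: "'i set" and n :: "'i \<Rightarrow> nat" and X :: "'i \<Rightarrow> (nat \<Rightarrow> real) set"
    and R :: "'i \<Rightarrow> ('i \<Rightarrow> nat \<Rightarrow> real) \<Rightarrow> ('i \<Rightarrow> nat \<Rightarrow> real) \<Rightarrow> bool"
    and K :: "'i \<Rightarrow> ('i \<Rightarrow> nat \<Rightarrow> real) \<Rightarrow> (nat \<Rightarrow> real) set"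
  assumes finI: "finite I"
    and X_ne: "\<And>\<nu>. \<nu> \<in> I \<Longrightarrow> X \<nu> \<noteq> {}"
    and X_cvx: "\<And>\<nu>. \<nu> \<in> I \<Longrightarrow> fconvex (X \<nu>)"
    and X_cpt: "\<And>\<nu>. \<nu> \<in> I \<Longrightarrow> compactin (Euclidean_space (n \<nu>)) (X \<nu>)"
    and K_cont: "\<And>\<nu>. \<nu> \<in> I \<Longrightarrow>
       hcont (subtopology (product_topology (\<lambda>j. Euclidean_space (n j)) (I - {\<nu>})) (PiE (I - {\<nu>}) X))
             (Euclidean_space (n \<nu>)) (K \<nu>)"
    and K_vals: "\<And>\<nu> z. \<nu> \<in> I \<Longrightarrow> z \<in> PiE (I - {\<nu>}) X \<Longrightarrow>
       K \<nu> z \<subseteq> X \<nu> \<and> K \<nu> z \<noteq> {} \<and> closedin (Euclidean_space (n \<nu>)) (K \<nu> z) \<and> fconvex (K \<nu> z)"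
    and U_cvx_open: "\<And>\<nu> x. \<nu> \<in> I \<Longrightarrow> x \<in> topspace (prof_top I n) \<Longrightarrow>
       fconvex (Us n R \<nu> x) \<and> openin (Euclidean_space (n \<nu>)) (Us n R \<nu> x)"
    and U_lhc: "\<And>\<nu>. \<nu> \<in> I \<Longrightarrow> lhc (prof_top I n) (Euclidean_space (n \<nu>)) (Us n R \<nu>)"
  shows "\<exists>xh. is_GNE I X R K xh"
proof -
  note X_Euclidean = compactin_subset_topspace[OF X_cpt]
  note profiles = PiE_subset_topspace_prof_top[of I X n, OF X_Euclidean]
  have others: "restrict z (I - {\<nu>}) \<in> PiE (I - {\<nu>}) X" if "z \<in> PiE I X" for z \<nu>
    using that by auto
  interpret abstract_economy I n X "\<lambda>\<nu> z. K \<nu> (restrict z (I - {\<nu>}))" "Us n R"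
  proof
    fix \<nu> assume \<nu>: "\<nu> \<in> I"
    show "hcont (profile_space I X) (Euclidean_space (n \<nu>)) (\<lambda>z. K \<nu> (restrict z (I - {\<nu>})))"
      by (rule hcont_restrict_profile_space[OF X_Euclidean _ K_cont[OF \<nu>]]) auto
    show "openin (prod_topology (profile_space I X) (Euclidean_space (n \<nu>)))
        (SIGMA z:PiE I X. Us n R \<nu> z)"
      by (rule openin_graph_profile_space[OF X_Euclidean U_lhc[OF \<nu>] U_cvx_open[OF \<nu>]])
    show "z \<nu> \<notin> Us n R \<nu> z" for z
      by (simp add: Us_def strict_pref_def)
  qed (use X_ne X_cvx X_cpt K_vals[OF _ others] U_cvx_open profiles in auto)
  obtain z where z: "z \<in> PiE I X" and equilibrium: "\<And>\<nu>. \<nu> \<in> I \<Longrightarrow> z \<nu> \<in> K \<nu> (restrict z (I - {\<nu>})) \<and>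
      K \<nu> (restrict z (I - {\<nu>})) \<inter> Us n R \<nu> z = {}"
    using equilibrium_exists by blast
  show ?thesis
    using equilibrium subset_trans[OF C_subset[OF _ z] X_Euclidean]
    by (intro exI[of _ z] is_GNEI[where n = n] z) simp_all
qed

end
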